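(* (1) Let $D=\mathrm{diag}(d_1,\dots,d_N)$ with $d_1,\dots,d_N\in\mathbb C$. Assuming that $D+U_N$ is invertible, i.e. that $c_0(D)>0$, $$\frac{1}{\rho_N(D)}\le s_{\min}^2(D+U_N)\le\frac{c_0(D)}{\gamma_N(D)}.$$ (2) Let $\sigma\in\mathcal S_N$ have cycles $C_1,\dots,C_{K(\sigma)}$ of lengths $N_1,\dots,N_{K(\sigma)}$, with associated diagonal matrices $D_1,\dots,D_{K(\sigma)}$, and let $A=D+M_\sigma$. Assuming that $A$ is invertible, i.e. that $c_0(D_i)>0$ for $1\le i\le K(\sigma)$, $$\min_{1\le i\le K(\sigma)}\frac{1}{\rho_{N_i}(D_i)}\le s_{\min}^2(A)\le\min_{1\le i\le K(\sigma)}\frac{c_0(D_i)}{\gamma_{N_i}(D_i)}.$$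
   Context: $\mathcal S_N$ is the symmetric group; $M_\sigma$ is the $N\times N$ matrix with $M_\sigma(i,j)=1$ if $\sigma(i)=j$ and $0$ otherwise; $s_{\min}$ is the smallest singular value. Cycles are written $C_i=(n_i,\sigma(n_i),\dots,\sigma^{N_i-1}(n_i))$ (fixed points are cycles of length 1) and $D_i=\mathrm{diag}(d_{n_i},d_{\sigma(n_i)},\dots,d_{\sigma^{N_i-1}(n_i)})$. $U_n$ is the $n\times n$ cyclic shift: $(U_n)_{k,k+1}=1$ for $1\le k\le n-1$, $(U_n)_{n,1}=1$, other entries $0$. For a diagonal matrix $D=\mathrm{diag}(d_1,\dots,d_N)$ of size $N$ define: - $c_0(D)=|\det(D+U_N)|^2=\big|(-1)^N-\prod_{l=1}^N d_l\big|^2$; - $\beta_{k,m}=\beta_{k,m}(D)=(-1)^{m-k+1}\prod_{l=k}^m d_l$ for $1\le k\le m\le N$; $\beta_{k,k-1}=1$ for $1\le k\le N+1$; and $\beta_{k,m}=0$ for $m<k-1$; - $\gamma_N(D)=\max_{1\le k\le N}\sum_{m=1}^N|\beta_{k,m}|^2$; - when $c_0(D)>0$, $\rho_N(D)=2\big(\rho_N^{(1)}(D)+\rho_N^{(2)}(D)\big)$, where $\rho_N^{(1)}(D)=\frac{1}{c_0(D)}\Big(\sum_{k=1}^N|\beta_{1,k-1}|^2\Big)\Big(\sum_{m=1}^N|\beta_{m+1,N}|^2\Big)$ and $\rho_N^{(2)}(D)=\sum_{1\le k\le m-1\le N}|\beta_{k+1,m-1}|^2$ (sum over pairs of integers $(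k,m)$).
   Formalization: In γ_N(D) the k=1 sum is taken as Σ_{m=1}^N |β_{1,m-1}|² instead of Σ_{m=1}^N |β_{1,m}|² (sums for k≥2 unchanged), because the printed upper bound is false: N=1, d_1=2 would give 9 ≤ 9/4. *)

theory Defs
  imports
    "HOL-Analysis.Analysis"
    "HOL-Combinatorics.Permutations"
    "HOL-Combinatorics.Cycles"
    "Jordan_Normal_Form.Matrix"
    "Jordan_Normal_Form.Determinant"
    "Jordan_Normal_Form.Char_Poly"
    "Jordan_Normal_Form.Schur_Decomposition"
begin

text \<open>Permutations and the entries \<open>d\<^sub>1, \<dots>, d\<^sub>N\<close> are indexed from 1, whereas the
  matrix library indexes from 0; the shift happens only in the following definition.\<close>

definition mat1 :: "nat \<Rightarrow> (nat \<Rightarrow> nat \<Rightarrow> complex) \<Rightarrow> complex mat" where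
  "mat1 n f = mat n n (\<lambda>(i, j). f (i + 1) (j + 1))"

definition diag_matrix :: "nat \<Rightarrow> (nat \<Rightarrow> complex) \<Rightarrow> complex mat" where
  "diag_matrix n d = mat1 n (\<lambda>i j. if i = j then d i else 0)"

definition cyclic_shift :: "nat \<Rightarrow> complex mat" where
  "cyclic_shift n = mat1 n (\<lambda>k l. if l = k + 1 \<or> (k = n \<and> l = 1) then 1 else 0)"

definition perm_matrix :: "nat \<Rightarrow> (nat \<Rightarrow> nat) \<Rightarrow> complex mat" where
  "perm_matrix n \<sigma> = mat1 n (\<lambda>i j. if \<sigma> i = j then 1 else 0)"

text \<open>The singular values are the square roots of the eigenvalues of \<open>A\<^sup>* A\<close>.\<close>

definition singular_values :: "complex mat \<Rightarrow> real set" where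
  "singular_values A = {s. 0 \<le> s \<and> eigenvalue (mat_adjoint A * A) (complex_of_real (s\<^sup>2))}"

definition s_min :: "complex mat \<Rightarrow> real" where
  "s_min A = Min (singular_values A)"

definition c_zero :: "nat \<Rightarrow> (nat \<Rightarrow> complex) \<Rightarrow> real" where
  "c_zero N d = (cmod (det (diag_matrix N d + cyclic_shift N)))\<^sup>2"

text \<open>For \<open>m = k - 1\<close> the product is empty and the value is 1.\<close>

definition beta :: "(nat \<Rightarrow> complex) \<Rightarrow> nat \<Rightarrow> nat \<Rightarrow> complex" where
  "beta d k m = (if m + 1 < k then 0 else (- 1) ^ (m + 1 - k) * (\<Prod>l = k..m. d l))"

text \<open>
  The quantity \<open>\<gamma>\<^sub>N\<close> is the maximum over \<open>k\<close> of sums of \<open>N\<close> terms \<open>|\<beta>\<^sub>k\<^sub>,\<^sub>m|\<^sup>2\<close>.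
  For \<open>k \<ge> 2\<close> the sum runs over \<open>1 \<le> m \<le> N\<close>. For \<open>k = 1\<close> it has to run over
  \<open>0 \<le> m \<le> N - 1\<close>, as does the first factor in \<open>\<rho>\<^sub>N\<^sup>(\<^sup>1\<^sup>)\<close>. Divided by \<open>c\<^sub>0(D)\<close>,
  these sums are then (partial) squared norms of columns of the inverse of \<open>D + U\<^sub>N\<close>: column
  \<open>k - 1\<close> for \<open>k \<ge> 2\<close>, column \<open>N\<close> for \<open>k = 1\<close>. With the range \<open>1 \<le> m \<le> N\<close> also for
  \<open>k = 1\<close>, the bound \<open>s\<^sub>m\<^sub>i\<^sub>n\<^sup>2 \<le> c\<^sub>0/\<gamma>\<^sub>N\<close> is false: for \<open>N = 1\<close>, \<open>d\<^sub>1 = 2\<close> it reads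
  \<open>9 \<le> 9/4\<close>; for \<open>N = 2\<close>, \<open>d\<^sub>1 = d\<^sub>2 = 3\<close> it reads \<open>4 \<le> 64/90\<close>.
\<close>

definition gamma_N :: "nat \<Rightarrow> (nat \<Rightarrow> complex) \<Rightarrow> real" where
  "gamma_N N d =
     (MAX k\<in>{1..N}. if k = 1 then \<Sum>m = 1..N. (cmod (beta d 1 (m - 1)))\<^sup>2
                    else \<Sum>m = 1..N. (cmod (beta d k m))\<^sup>2)"

definition rho1 :: "nat \<Rightarrow> (nat \<Rightarrow> complex) \<Rightarrow> real" where
  "rho1 N d = 1 / c_zero N d * (\<Sum>k = 1..N. (cmod (beta d 1 (k - 1)))\<^sup>2)
                             * (\<Sum>m = 1..N. (cmod (beta d (m + 1) N))\<^sup>2)"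

definition rho2 :: "nat \<Rightarrow> (nat \<Rightarrow> complex) \<Rightarrow> real" where
  "rho2 N d = (\<Sum>(k, m) \<in> {(k, m). 1 \<le> k \<and> k \<le> m - 1 \<and> m - 1 \<le> N}.
                 (cmod (beta d (k + 1) (m - 1)))\<^sup>2)"

definition rho_N :: "nat \<Rightarrow> (nat \<Rightarrow> complex) \<Rightarrow> real" where
  "rho_N N d = 2 * (rho1 N d + rho2 N d)"

text \<open>The list \<open>support \<sigma> x\<close> is the cycle \<open>(x, \<sigma> x, \<sigma>\<^sup>2 x, \<dots>)\<close> of \<open>\<sigma>\<close> through \<open>x\<close>.
  In \<open>cycles_of N \<sigma> K n\<close>, the cycles of \<open>\<sigma>\<close> on \<open>{1..N}\<close>, including fixed points, are
  \<open>C\<^sub>1, \<dots>, C\<^sub>K\<close> without repetition, where \<open>C\<^sub>i\<close> starts at \<open>n i\<close>. Neither the order of the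
  cycles nor the starting points are prescribed.\<close>

definition cycles_of :: "nat \<Rightarrow> (nat \<Rightarrow> nat) \<Rightarrow> nat \<Rightarrow> (nat \<Rightarrow> nat) \<Rightarrow> bool" where
  "cycles_of N \<sigma> K n \<longleftrightarrow>
     (\<forall>i\<in>{1..K}. n i \<in> {1..N}) \<and>
     (\<forall>x\<in>{1..N}. \<exists>!i. i \<in> {1..K} \<and> x \<in> set (support \<sigma> (n i)))"

definition cycle_length :: "(nat \<Rightarrow> nat) \<Rightarrow> nat \<Rightarrow> nat" where
  "cycle_length \<sigma> x = length (support \<sigma> x)"

definition cycle_diag :: "(nat \<Rightarrow> complex) \<Rightarrow> (nat \<Rightarrow> nat) \<Rightarrow> nat \<Rightarrow> nat \<Rightarrow> complex" where
  "cycle_diag d \<sigma> x l = d ((\<sigma> ^^ (l - 1)) x)"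

end

theory Submission
  imports Defs
begin

text \<open>The matrix \<open>A = D + M\<^sub>\<sigma>\<close> acts by \<open>(A x)\<^sub>j = d\<^sub>j x\<^sub>j + x\<^bsub>\<sigma>(j)\<^esub>\<close>, so it only couples the
  entries of \<open>x\<close> on one cycle of \<open>\<sigma>\<close>. Both \<open>\<bar>x\<bar>\<^sup>2\<close> and \<open>\<bar>A x\<bar>\<^sup>2\<close> are sums over the cycles, and
  \<open>s\<^sub>m\<^sub>i\<^sub>n\<^sup>2\<close> is the minimum of \<open>\<bar>A x\<bar>\<^sup>2 / \<bar>x\<bar>\<^sup>2\<close>. A lower bound for \<open>s\<^sub>m\<^sub>i\<^sub>n\<^sup>2\<close> therefore needs an estimate
  of \<open>\<bar>x\<bar>\<^sup>2\<close> by \<open>\<bar>A x\<bar>\<^sup>2\<close> on every cycle, and an upper bound needs one good vector on one cycle.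

  On a cycle of length \<open>N\<close> the equation \<open>A x = y\<close> is the recurrence \<open>x\<^sub>k\<^sub>+\<^sub>1 = y\<^sub>k - d\<^sub>k x\<^sub>k\<close> with
  indices modulo \<open>N\<close>. Unrolling it from \<open>x\<^sub>1\<close> gives
  \<open>x\<^sub>m = \<beta>\<^sub>1\<^sub>,\<^sub>m\<^sub>-\<^sub>1 x\<^sub>1 + \<Sum>\<^sub>k\<^sub><\<^sub>m \<beta>\<^sub>k\<^sub>+\<^sub>1\<^sub>,\<^sub>m\<^sub>-\<^sub>1 y\<^sub>k\<close>, and closing the cycle gives
  \<open>(1 - \<beta>\<^sub>1\<^sub>,\<^sub>N) x\<^sub>1 = \<Sum>\<^sub>k \<beta>\<^sub>k\<^sub>+\<^sub>1\<^sub>,\<^sub>N y\<^sub>k\<close>, where \<open>c\<^sub>0 = \<bar>1 - \<beta>\<^sub>1\<^sub>,\<^sub>N\<bar>\<^sup>2\<close>. Cauchy--Schwarz applied to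
  these two formulas, with \<open>\<bar>a + b\<bar>\<^sup>2 \<le> 2 \<bar>a\<bar>\<^sup>2 + 2 \<bar>b\<bar>\<^sup>2\<close> to separate the two terms of \<open>x\<^sub>m\<close>, yields
  \<open>\<bar>x\<bar>\<^sup>2 \<le> \<rho>\<^sub>N \<bar>y\<bar>\<^sup>2\<close> (\<open>cycle_sum_squares_le_rho\<close>). In the other direction, the solution whose
  right-hand side has \<open>1 - \<beta>\<^sub>1\<^sub>,\<^sub>N\<close> as its only nonzero entry is this factor times a column of the
  inverse; its entries are products of \<open>\<beta>\<close>'s and its squared norm is at least the corresponding sum in \<open>\<gamma>\<^sub>N\<close> (\<open>cycle_test_sequence_gamma\<close>).

  That \<open>s\<^sub>m\<^sub>i\<^sub>n\<^sup>2\<close> is the minimum of the quotient is shown without diagonalising \<open>A\<^sup>* A\<close>: if the infimum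
  \<open>\<mu>\<close> of the quotient were not an eigenvalue of \<open>A\<^sup>* A\<close>, then the positive semidefinite matrix
  \<open>A\<^sup>* A - \<mu>\<close> would be invertible, hence bounded below by some \<open>\<epsilon> > 0\<close>, and the infimum would be at least
  \<open>\<mu> + \<epsilon>\<close> (\<open>rayleigh_infimum_eigenvalue\<close>).

  The locale \<open>cycle_partition\<close> carries out the decomposition for any map whose action on \<open>{1..N}\<close> is
  parametrised by cycles. The cyclic shift \<open>U\<^sub>N\<close> is the instance with a single cycle enumerated
  identically, and a permutation with chosen starting points is the general instance.\<close>

no_notation Finite_Cartesian_Product.vec_nth (infixl "$" 90)
no_notation Inner_Product.real_inner_class.inner (infix "\<bullet>" 70)

section \<open>The smallest singular value as a minimal Rayleigh quotient\<close>

lemma norm_sum_mult_square_le: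
  fixes a b :: "'i \<Rightarrow> complex"
  shows "(cmod (\<Sum>j\<in>J. a j * b j))\<^sup>2 \<le> (\<Sum>j\<in>J. (cmod (a j))\<^sup>2) * (\<Sum>j\<in>J. (cmod (b j))\<^sup>2)"
proof -
  have "cmod (\<Sum>j\<in>J. a j * b j) \<le> (\<Sum>j\<in>J. cmod (a j) * cmod (b j))"
    by (rule order_trans[OF norm_sum]) (simp add: norm_mult)
  then have "(cmod (\<Sum>j\<in>J. a j * b j))\<^sup>2 \<le> (\<Sum>j\<in>J. cmod (a j) * cmod (b j))\<^sup>2"
    by (intro power_mono) auto
  also have "\<dots> \<le> (\<Sum>j\<in>J. (cmod (a j))\<^sup>2) * (\<Sum>j\<in>J. (cmod (b j))\<^sup>2)"
    by (rule Cauchy_Schwarz_ineq_sum)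
  finally show ?thesis .
qed

definition sqnorm :: "complex vec \<Rightarrow> real" where
  "sqnorm v = (\<Sum>i<dim_vec v. (cmod (v $ i))\<^sup>2)"

lemma sqnorm_nonneg [simp]: "0 \<le> sqnorm v"
  by (simp add: sqnorm_def sum_nonneg)

lemma cscalar_prod_self: "v \<bullet>c v = complex_of_real (sqnorm v)"
  by (simp add: sqnorm_def scalar_prod_def complex_norm_square lessThan_atLeast0 del: of_real_power)

lemma sqnorm_eq_0_iff: "v \<in> carrier_vec n \<Longrightarrow> sqnorm v = 0 \<longleftrightarrow> v = 0\<^sub>v n"
  by (auto simp: sqnorm_def sum_nonneg_eq_0_iff intro!: eq_vecI)

lemma sqnorm_pos: "v \<in> carrier_vec n \<Longrightarrow> v \<noteq> 0\<^sub>v n \<Longrightarrow> 0 < sqnorm v"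
  using sqnorm_eq_0_iff[of v n] sqnorm_nonneg[of v] by linarith

lemma cmod_diff_square:
  "(cmod (a - of_real t * b))\<^sup>2 = (cmod a)\<^sup>2 - 2 * t * Re (a * cnj b) + t\<^sup>2 * (cmod b)\<^sup>2"
  unfolding cmod_power2 by (simp add: power2_eq_square algebra_simps)

text \<open>The expansion is needed for real \<open>t\<close> only: the variation in the Rayleigh quotient argument moves
  along a real line.\<close>

lemma sqnorm_diff_smult:
  assumes v: "v \<in> carrier_vec n" and w: "w \<in> carrier_vec n"
  shows "sqnorm (v - of_real t \<cdot>\<^sub>v w) = sqnorm v - 2 * t * Re (v \<bullet>c w) + t\<^sup>2 * sqnorm w"
proof -
  have re: "Re (v \<bullet>c w) = (\<Sum>i<n. Re (v $ i * cnj (w $ i)))"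
    using v w by (simp add: scalar_prod_def lessThan_atLeast0)
  have "sqnorm (v - of_real t \<cdot>\<^sub>v w) =
      (\<Sum>i<n. (cmod (v $ i))\<^sup>2 - 2 * t * Re (v $ i * cnj (w $ i)) + t\<^sup>2 * (cmod (w $ i))\<^sup>2)"
    using v w by (simp add: sqnorm_def cmod_diff_square)
  also have "\<dots> = sqnorm v - 2 * t * Re (v \<bullet>c w) + t\<^sup>2 * sqnorm w"
    using v w re
    by (simp only: sqnorm_def sum.distrib sum_subtractf sum_distrib_left carrier_vecD)
  finally show ?thesis .
qed

text \<open>By Cauchy--Schwarz in every row, the squared Frobenius norm is such a constant. Adding 1 makes it
  positive, so that it can be divided by.\<close>

lemma mat_sqnorm_bound:
  assumes A: "(A :: complex mat) \<in> carrier_mat n m"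
  obtains C where "0 < C" "\<And>v. v \<in> carrier_vec m \<Longrightarrow> sqnorm (A *\<^sub>v v) \<le> C * sqnorm v"
proof
  let ?C = "\<Sum>i<n. \<Sum>j<m. (cmod (A $$ (i, j)))\<^sup>2"
  show "0 < 1 + ?C"
    by (intro add_pos_nonneg sum_nonneg) auto
  fix v :: "complex vec" assume v: "v \<in> carrier_vec m"
  have "sqnorm (A *\<^sub>v v) = (\<Sum>i<n. (cmod (\<Sum>j<m. A $$ (i, j) * v $ j))\<^sup>2)"
    using A v by (simp add: sqnorm_def scalar_prod_def lessThan_atLeast0)
  also have "\<dots> \<le> (\<Sum>i<n. (\<Sum>j<m. (cmod (A $$ (i, j)))\<^sup>2) * sqnorm v)"
    using v by (intro sum_mono order_trans[OF norm_sum_mult_square_le]) (simp add: sqnorm_def)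
  also have "\<dots> = ?C * sqnorm v"
    by (simp add: sum_distrib_right)
  also have "\<dots> \<le> (1 + ?C) * sqnorm v"
    by (simp add: distrib_right)
  finally show "sqnorm (A *\<^sub>v v) \<le> (1 + ?C) * sqnorm v" .
qed

lemma mat_adjoint_carrier: 
  assumes "A \<in> carrier_mat n m" shows "mat_adjoint A \<in> carrier_mat m n"
  using assms unfolding mat_adjoint_def carrier_mat_def by auto

lemma cscalar_prod_mat_adjoint:
  assumes A: "(A :: complex mat) \<in> carrier_mat n m" and v: "v \<in> carrier_vec n" and w: "w \<in> carrier_vec m"
  shows "(mat_adjoint A *\<^sub>v v) \<bullet>c w = v \<bullet>c (A *\<^sub>v w)"
proof -
  have adj: "mat_adjoint A $$ (j, i) = cnj (A $$ (i, j))" if "i < n" "j < m" for i j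
    using A that by (simp add: mat_adjoint_def mat_of_rows_def cols_def)
  have "(mat_adjoint A *\<^sub>v v) \<bullet>c w = (\<Sum>j<m. \<Sum>i<n. cnj (A $$ (i, j)) * v $ i * cnj (w $ j))"
    using A v w mat_adjoint_carrier[OF A]
    by (simp add: scalar_prod_def adj lessThan_atLeast0 sum_distrib_right)
  also have "\<dots> = (\<Sum>i<n. \<Sum>j<m. cnj (A $$ (i, j)) * v $ i * cnj (w $ j))"
    by (rule sum.swap)
  also have "\<dots> = v \<bullet>c (A *\<^sub>v w)"
    using A v w by (simp add: scalar_prod_def lessThan_atLeast0 sum_distrib_left mult_ac)
  finally show ?thesis .
qed

lemma invertible_mat_iff_kernel:
  assumes A: "(A :: complex mat) \<in> carrier_mat n n"
  shows "invertible_mat A \<longleftrightarrow> (\<forall>v\<in>carrier_vec n. A *\<^sub>v v = 0\<^sub>v n \<longrightarrow> v = 0\<^sub>v n)"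
proof
  assume "invertible_mat A"
  then obtain B where AB: "A * B = 1\<^sub>m n" and BA: "B * A = 1\<^sub>m (dim_row B)"
    using A by (auto simp: invertible_mat_def inverts_mat_def)
  have B: "B \<in> carrier_mat n n"
    using arg_cong[OF AB, of dim_col] arg_cong[OF BA, of dim_col] A by auto
  show "\<forall>v\<in>carrier_vec n. A *\<^sub>v v = 0\<^sub>v n \<longrightarrow> v = 0\<^sub>v n"
  proof (intro ballI impI)
    fix v assume v: "v \<in> carrier_vec n" and 0: "A *\<^sub>v v = 0\<^sub>v n"
    have "v = (B * A) *\<^sub>v v"
      using BA B v by simp
    also have "\<dots> = B *\<^sub>v (A *\<^sub>v v)"
      using A B v by simp
    also have "\<dots> = 0\<^sub>v n"
      using B by (auto simp: 0 scalar_prod_def intro!: eq_vecI)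
    finally show "v = 0\<^sub>v n" .
  qed
next
  assume "\<forall>v\<in>carrier_vec n. A *\<^sub>v v = 0\<^sub>v n \<longrightarrow> v = 0\<^sub>v n"
  then have "det A \<noteq> 0"
    using det_0_iff_vec_prod_zero_field[OF A] by blast
  from det_non_zero_imp_unit[OF A this, unfolded Units_def, of "()"]
  obtain B where "B \<in> carrier_mat n n" "B * A = 1\<^sub>m n" "A * B = 1\<^sub>m n"
    by (auto simp: ring_mat_def)
  then show "invertible_mat A"
    using A by (auto simp: invertible_mat_def inverts_mat_def)
qed

text \<open>The constant is a bound for the inverse matrix.\<close>

lemma coercive_of_trivial_kernel:
  assumes A: "(A :: complex mat) \<in> carrier_mat n n"
    and ker: "\<And>v. v \<in> carrier_vec n \<Longrightarrow> A *\<^sub>v v = 0\<^sub>v n \<Longrightarrow> v = 0\<^sub>v n"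
  obtains C where "0 < C" "\<And>v. v \<in> carrier_vec n \<Longrightarrow> sqnorm v \<le> C * sqnorm (A *\<^sub>v v)"
proof -
  have "det A \<noteq> 0"
    using det_0_iff_vec_prod_zero_field[OF A] ker by blast
  from det_non_zero_imp_unit[OF A this, unfolded Units_def, of "()"]
  obtain B where B: "B \<in> carrier_mat n n" and BA: "B * A = 1\<^sub>m n"
    by (auto simp: ring_mat_def)
  obtain C where C: "0 < C" "\<And>v. v \<in> carrier_vec n \<Longrightarrow> sqnorm (B *\<^sub>v v) \<le> C * sqnorm v"
    using mat_sqnorm_bound[OF B] by blast
  show ?thesis
  proof
    fix v :: "complex vec" assume v: "v \<in> carrier_vec n"
    have "v = (B * A) *\<^sub>v v"
      using BA B v by simp
    also have "\<dots> = B *\<^sub>v (A *\<^sub>v v)"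
      using A B v by simp
    finally show "sqnorm v \<le> C * sqnorm (A *\<^sub>v v)"
      using C(2)[of "A *\<^sub>v v"] A v by simp
  qed (fact C)
qed

lemma sqnorm_eigenvector:
  assumes A: "A \<in> carrier_mat n n"
    and v: "v \<in> carrier_vec n" and ev: "(mat_adjoint A * A) *\<^sub>v v = of_real t \<cdot>\<^sub>v v"
  shows "sqnorm (A *\<^sub>v v) = t * sqnorm v"
proof -
  note adj = mat_adjoint_carrier[OF A]
  have "complex_of_real (sqnorm (A *\<^sub>v v)) = (mat_adjoint A *\<^sub>v (A *\<^sub>v v)) \<bullet>c v"
    using cscalar_prod_mat_adjoint[OF A, of "A *\<^sub>v v" v] A v by (simp add: cscalar_prod_self)
  also have "mat_adjoint A *\<^sub>v (A *\<^sub>v v) = of_real t \<cdot>\<^sub>v v"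
    using ev A adj v by simp
  also have "(of_real t \<cdot>\<^sub>v v) \<bullet>c v = complex_of_real (t * sqnorm v)"
    using v by (simp add: cscalar_prod_self)
  finally show ?thesis
    using of_real_eq_iff by blast
qed

text \<open>Let \<open>\<mu>\<close> be the infimum of \<open>\<bar>A v\<bar>\<^sup>2 / \<bar>v\<bar>\<^sup>2\<close>, \<open>M = A\<^sup>* A - \<mu>\<close> and
  \<open>q(v) = \<bar>A v\<bar>\<^sup>2 - \<mu> \<bar>v\<bar>\<^sup>2\<close>, the quadratic form of \<open>M\<close>. Then \<open>q \<ge> 0\<close>, and evaluating \<open>q\<close> at
  \<open>v - t M v\<close> shows \<open>\<bar>M v\<bar>\<^sup>2 \<le> K q(v)\<close>, where \<open>K\<close> bounds the quotient from above. If \<open>M\<close> had trivial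
  kernel, then \<open>\<bar>v\<bar>\<^sup>2 \<le> C \<bar>M v\<bar>\<^sup>2 \<le> C K q(v)\<close>, which makes \<open>\<mu> + 1/(C K)\<close> a lower bound of the
  quotient. This contradicts the choice of \<open>\<mu>\<close>.\<close>

lemma rayleigh_infimum_eigenvalue:
  fixes A :: "complex mat"
  assumes A: "A \<in> carrier_mat n n" and n: "0 < n"
  obtains \<mu> where "0 \<le> \<mu>" "eigenvalue (mat_adjoint A * A) (of_real \<mu>)"
    "\<And>v. v \<in> carrier_vec n \<Longrightarrow> \<mu> * sqnorm v \<le> sqnorm (A *\<^sub>v v)"
proof -
  define Q where "Q = (\<lambda>v. sqnorm (A *\<^sub>v v) / sqnorm v) ` (carrier_vec n - {0\<^sub>v n})"
  define \<mu> where "\<mu> = Inf Q"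
  have "unit_vec n 0 \<in> carrier_vec n - {0\<^sub>v n}"
    using n by auto
  then have Q_ne: "Q \<noteq> {}"
    unfolding Q_def by blast
  have Q_bdd: "bdd_below Q"
    by (rule bdd_belowI[of _ 0]) (auto simp: Q_def)
  have \<mu>_nonneg: "0 \<le> \<mu>"
    unfolding \<mu>_def using Q_ne by (rule cInf_greatest) (auto simp: Q_def)
  have \<mu>_le: "\<mu> * sqnorm v \<le> sqnorm (A *\<^sub>v v)" if v: "v \<in> carrier_vec n" for v
  proof (cases "v = 0\<^sub>v n")
    case True
    then show ?thesis by (simp add: sqnorm_def sum_nonneg)
  next
    case False
    then have "\<mu> \<le> sqnorm (A *\<^sub>v v) / sqnorm v"
      unfolding \<mu>_def using v by (intro cInf_lower[OF _ Q_bdd]) (auto simp: Q_def)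
    then show ?thesis
      using sqnorm_pos[OF v False] by (simp add: pos_le_divide_eq)
  qed
  note adj = mat_adjoint_carrier[OF A]
  define M where "M = mat_adjoint A * A - of_real \<mu> \<cdot>\<^sub>m 1\<^sub>m n"
  have M: "M \<in> carrier_mat n n"
    using A adj by (auto simp: M_def)
  have Mv: "M *\<^sub>v v = (mat_adjoint A * A) *\<^sub>v v - of_real \<mu> \<cdot>\<^sub>v v" if v: "v \<in> carrier_vec n" for v
  proof -
    have "(of_real \<mu> \<cdot>\<^sub>m 1\<^sub>m n) *\<^sub>v v = of_real \<mu> \<cdot>\<^sub>v v"
      using v by (intro eq_vecI) (auto simp: smult_scalar_prod_distrib[where n=n])
    then show ?thesis
      using A adj v by (simp add: M_def minus_mult_distrib_mat_vec[where nr=n and nc=n])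
  qed
  have "\<exists>v\<in>carrier_vec n. v \<noteq> 0\<^sub>v n \<and> M *\<^sub>v v = 0\<^sub>v n"
  proof (rule ccontr)
    assume "\<not> ?thesis"
    then obtain C where C: "0 < C" "\<And>v. v \<in> carrier_vec n \<Longrightarrow> sqnorm v \<le> C * sqnorm (M *\<^sub>v v)"
      using coercive_of_trivial_kernel[OF M] by metis
    obtain K where K: "0 < K" "\<And>v. v \<in> carrier_vec n \<Longrightarrow> sqnorm (A *\<^sub>v v) \<le> K * sqnorm v"
      using mat_sqnorm_bound[OF A] by blast
    have M_le: "sqnorm (M *\<^sub>v v) \<le> K * (sqnorm (A *\<^sub>v v) - \<mu> * sqnorm v)" if v: "v \<in> carrier_vec n" for v
    proof -
      define w where "w = M *\<^sub>v v"
      have w: "w \<in> carrier_vec n"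
        using M v by (auto simp: w_def)
      have Av: "A *\<^sub>v v \<in> carrier_vec n" and Aw: "A *\<^sub>v w \<in> carrier_vec n"
        using A v w by auto
      have "w \<bullet>c w = (mat_adjoint A *\<^sub>v (A *\<^sub>v v)) \<bullet>c w - of_real \<mu> * (v \<bullet>c w)"
        using A adj v w Mv[OF v] 
        by (subst (1) w_def) (simp add: minus_scalar_prod_distrib[where n=n])
      also have "\<dots> = (A *\<^sub>v v) \<bullet>c (A *\<^sub>v w) - of_real \<mu> * (v \<bullet>c w)"
        using cscalar_prod_mat_adjoint[OF A Av w] by simp
      finally have ww: "sqnorm w = Re ((A *\<^sub>v v) \<bullet>c (A *\<^sub>v w)) - \<mu> * Re (v \<bullet>c w)"
        by (simp add: cscalar_prod_self complex_eq_iff)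
      have Atw: "A *\<^sub>v (v - of_real t \<cdot>\<^sub>v w) = A *\<^sub>v v - of_real t \<cdot>\<^sub>v (A *\<^sub>v w)" for t
        using A v w by (simp add: mult_minus_distrib_mat_vec[where nr=n and nc=n] mult_mat_vec[where nr=n and nc=n])
      \<comment> \<open>The value \<open>1 / K\<close> minimises the quadratic bound \<open>- 2 t \<bar>w\<bar>\<^sup>2 + t\<^sup>2 K \<bar>w\<bar>\<^sup>2\<close> obtained below.\<close>
      define t where "t = 1 / K"
      have "0 \<le> sqnorm (A *\<^sub>v (v - of_real t \<cdot>\<^sub>v w)) - \<mu> * sqnorm (v - of_real t \<cdot>\<^sub>v w)"
        using \<mu>_le[of "v - of_real t \<cdot>\<^sub>v w"] v w by simp
      also have "\<dots> = (sqnorm (A *\<^sub>v v) - \<mu> * sqnorm v) - 2 * t * sqnorm w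
          + t\<^sup>2 * (sqnorm (A *\<^sub>v w) - \<mu> * sqnorm w)"
        unfolding Atw sqnorm_diff_smult[OF Av Aw] sqnorm_diff_smult[OF v w] ww
        by (simp add: algebra_simps)
      also have "\<dots> \<le> (sqnorm (A *\<^sub>v v) - \<mu> * sqnorm v) - 2 * t * sqnorm w + t\<^sup>2 * (K * sqnorm w)"
      proof -
        have "sqnorm (A *\<^sub>v w) - \<mu> * sqnorm w \<le> K * sqnorm w"
          using K(2)[OF w] mult_nonneg_nonneg[OF \<mu>_nonneg sqnorm_nonneg[of w]] by linarith
        then show ?thesis
          by (intro add_left_mono mult_left_mono) auto
      qed
      also have "t\<^sup>2 * (K * sqnorm w) = t * sqnorm w"
        using K(1) by (simp add: t_def power2_eq_square)
      finally have "t * sqnorm w \<le> sqnorm (A *\<^sub>v v) - \<mu> * sqnorm v"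
        by simp
      then show ?thesis
        using K(1) by (simp add: t_def w_def field_simps)
    qed
    define \<epsilon> where "\<epsilon> = 1 / (C * K)"
    have "0 < \<epsilon>"
      using C(1) K(1) by (simp add: \<epsilon>_def)
    have "\<mu> + \<epsilon> \<le> q" if "q \<in> Q" for q
    proof -
      obtain v where v: "v \<in> carrier_vec n" "v \<noteq> 0\<^sub>v n" and q: "q = sqnorm (A *\<^sub>v v) / sqnorm v"
        using \<open>q \<in> Q\<close> by (auto simp: Q_def)
      have "sqnorm v \<le> C * (K * (sqnorm (A *\<^sub>v v) - \<mu> * sqnorm v))"
        using C(2)[OF v(1)] mult_left_mono[OF M_le[OF v(1)], of C] C(1) by linarith
      then have "\<epsilon> * sqnorm v \<le> sqnorm (A *\<^sub>v v) - \<mu> * sqnorm v"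
        using C(1) K(1) by (simp add: \<epsilon>_def pos_divide_le_eq mult_ac)
      then show ?thesis
        using sqnorm_pos[OF v] by (simp add: q pos_le_divide_eq algebra_simps)
    qed
    then have "\<mu> + \<epsilon> \<le> \<mu>"
      unfolding \<mu>_def by (intro cInf_greatest[OF Q_ne])
    with \<open>0 < \<epsilon>\<close> show False by simp
  qed
  then obtain v where v: "v \<in> carrier_vec n" "v \<noteq> 0\<^sub>v n" "M *\<^sub>v v = 0\<^sub>v n"
    by blast
  have "(mat_adjoint A * A) *\<^sub>v v = of_real \<mu> \<cdot>\<^sub>v v"
  proof (rule eq_vecI)
    fix i assume "i < dim_vec (complex_of_real \<mu> \<cdot>\<^sub>v v)"
    then have i: "i < n" using v by simp
    have "((mat_adjoint A * A) *\<^sub>v v - of_real \<mu> \<cdot>\<^sub>v v) $ i = 0"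
      using v(3) Mv[OF v(1)] i by simp
    then show "((mat_adjoint A * A) *\<^sub>v v) $ i = (of_real \<mu> \<cdot>\<^sub>v v) $ i"
      using v(1) i by simp
  qed (use v(1) adj in simp)
  then have "eigenvalue (mat_adjoint A * A) (of_real \<mu>)"
    using v adj by (auto simp: eigenvalue_def eigenvector_def)
  with \<mu>_nonneg \<mu>_le show ?thesis
    using that by blast
qed

lemma finite_singular_values:
  assumes A: "A \<in> carrier_mat n n"
  shows "finite (singular_values A)"
proof -
  have H: "mat_adjoint A * A \<in> carrier_mat n n"
    using A mat_adjoint_carrier[OF A] by simp
  have "char_poly (mat_adjoint A * A) \<noteq> 0"
    using degree_monic_char_poly[OF H] by auto
  then have "finite {z. eigenvalue (mat_adjoint A * A) z}"
    using poly_roots_finite by (simp add: eigenvalue_root_char_poly[OF H])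
  then have "finite ((\<lambda>z. sqrt (Re z)) ` {z. eigenvalue (mat_adjoint A * A) z})"
    by (rule finite_imageI)
  moreover have "singular_values A \<subseteq> (\<lambda>z. sqrt (Re z)) ` {z. eigenvalue (mat_adjoint A * A) z}"
    by (force simp: singular_values_def)
  ultimately show ?thesis
    by (rule finite_subset[rotated])
qed

text \<open>The infimum of the quotient is itself the square of a singular value, so the least singular value
  cannot exceed its root.\<close>

lemma s_min_square_le:
  assumes A: "A \<in> carrier_mat n n" and v: "v \<in> carrier_vec n"
  shows "(s_min A)\<^sup>2 * sqnorm v \<le> sqnorm (A *\<^sub>v v)"
proof (cases "n = 0")
  case True
  then show ?thesis using v by (simp add: sqnorm_def sum_nonneg)
next
  case False
  then obtain \<mu> where \<mu>: "0 \<le> \<mu>" "eigenvalue (mat_adjoint A * A) (of_real \<mu>)"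
    "\<mu> * sqnorm v \<le> sqnorm (A *\<^sub>v v)"
    using rayleigh_infimum_eigenvalue[OF A] v by (metis neq0_conv)
  have s: "sqrt \<mu> \<in> singular_values A"
    using \<mu> by (simp add: singular_values_def del: of_real_power)
  have "s_min A \<in> singular_values A"
    unfolding s_min_def by (rule Min_in) (use finite_singular_values[OF A] s in auto)
  then have "0 \<le> s_min A"
    by (simp add: singular_values_def)
  moreover have "s_min A \<le> sqrt \<mu>"
    unfolding s_min_def using finite_singular_values[OF A] s by simp
  ultimately have "(s_min A)\<^sup>2 \<le> \<mu>"
    using \<mu>(1) power_mono[of "s_min A" "sqrt \<mu>" 2] by simp
  then have "(s_min A)\<^sup>2 * sqnorm v \<le> \<mu> * sqnorm v"
    by (simp add: mult_right_mono)
  with \<mu>(3) show ?thesis by simp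
qed

text \<open>A singular vector for \<open>s_min A\<close> attains the quotient \<open>(s_min A)\<^sup>2\<close>.\<close>

lemma le_s_min_square:
  assumes A: "A \<in> carrier_mat n n" and n: "0 < n"
    and r: "\<And>v. v \<in> carrier_vec n \<Longrightarrow> r * sqnorm v \<le> sqnorm (A *\<^sub>v v)"
  shows "r \<le> (s_min A)\<^sup>2"
proof -
  obtain \<mu> where \<mu>: "0 \<le> \<mu>" "eigenvalue (mat_adjoint A * A) (of_real \<mu>)"
    using rayleigh_infimum_eigenvalue[OF A n] by metis
  then have "sqrt \<mu> \<in> singular_values A"
    by (simp add: singular_values_def del: of_real_power)
  then have "s_min A \<in> singular_values A"
    unfolding s_min_def by (intro Min_in finite_singular_values[OF A]) auto
  then obtain v where v: "v \<in> carrier_vec n" "v \<noteq> 0\<^sub>v n"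
    and ev: "(mat_adjoint A * A) *\<^sub>v v = of_real ((s_min A)\<^sup>2) \<cdot>\<^sub>v v"
    using mat_adjoint_carrier[OF A]
    by (auto simp: singular_values_def eigenvalue_def eigenvector_def)
  have "r * sqnorm v \<le> (s_min A)\<^sup>2 * sqnorm v"
    using r[OF v(1)] sqnorm_eigenvector[OF A v(1) ev] by simp
  then show ?thesis
    using sqnorm_pos[OF v] by simp
qed

section \<open>Solving the equations along one cycle\<close>

definition cyc_next :: "nat \<Rightarrow> nat \<Rightarrow> nat" where
  "cyc_next N k = (if k = N then 1 else k + 1)"

lemma beta_empty [simp]: "beta d (Suc m) m = 1"
  by (simp add: beta_def)

lemma beta_Suc: "k \<le> Suc m \<Longrightarrow> beta d k (Suc m) = - d (Suc m) * beta d k m"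
  by (simp add: beta_def Suc_diff_le prod.nat_ivl_Suc')

text \<open>In the first column of \<open>D + U\<^sub>N\<close> the diagonal entry and the corner entry contribute to the Laplace expansion.
  Deleting the first row leaves an upper triangular matrix with diagonal \<open>d\<^sub>2, \<dots>, d\<^sub>N\<close>; deleting the
  last row leaves a lower triangular one with diagonal 1. For \<open>N = 1\<close> the two entries coincide and
  both minors are empty.\<close>

lemma c_zero_eq_beta:
  assumes N: "1 \<le> N"
  shows "c_zero N d = (cmod (1 - beta d 1 N))\<^sup>2"
proof -
  define A where "A = diag_matrix N d + cyclic_shift N"
  have A: "A \<in> carrier_mat N N"
    by (simp add: A_def diag_matrix_def cyclic_shift_def mat1_def)
  have entry: "A $$ (i, j) = (if i = j then d (i + 1) else 0)
      + (if j = i + 1 \<or> (i + 1 = N \<and> j = 0) then 1 else 0)" if "i < N" "j < N" for i j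
    using that by (simp add: A_def diag_matrix_def cyclic_shift_def mat1_def)
  have upper: "det (mat_delete A 0 0) = (\<Prod>l = 2..N. d l)"
  proof -
    have D: "mat_delete A 0 0 \<in> carrier_mat (N - 1) (N - 1)"
      using A by (simp add: mat_delete_def)
    have "upper_triangular (mat_delete A 0 0)"
      using A by (auto simp: upper_triangular_def mat_delete_def entry)
    then have "det (mat_delete A 0 0) = prod_list (diag_mat (mat_delete A 0 0))"
      using D by (rule det_upper_triangular)
    also have "diag_mat (mat_delete A 0 0) = map (\<lambda>i. d (i + 2)) [0..<N - 1]"
      using A by (auto simp: diag_mat_def mat_delete_def entry)
    also have "prod_list \<dots> = (\<Prod>i = 0..<N - 1. d (i + 2))"
      by (simp add: prod.distinct_set_conv_list[symmetric])
    also have "\<dots> = (\<Prod>l = 2..N. d l)"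
      by (rule prod.reindex_bij_witness[of _ "\<lambda>l. l - 2" "\<lambda>i. i + 2"]) auto
    finally show ?thesis .
  qed
  have lower: "det (mat_delete A (N - 1) 0) = 1"
  proof -
    have D: "mat_delete A (N - 1) 0 \<in> carrier_mat (N - 1) (N - 1)"
      using A by (simp add: mat_delete_def)
    have "det (mat_delete A (N - 1) 0) = prod_list (diag_mat (mat_delete A (N - 1) 0))"
      using A by (intro det_lower_triangular[OF _ D]) (simp add: mat_delete_def entry)
    also have "diag_mat (mat_delete A (N - 1) 0) = replicate (N - 1) 1"
      using A by (auto simp: diag_mat_def mat_delete_def entry intro!: nth_equalityI)
    also have "prod_list \<dots> = (1 :: complex)"
      by simp
    finally show ?thesis .
  qed
  have "det A = (\<Sum>i<N. A $$ (i, 0) * cofactor A i 0)"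
    using laplace_expansion_column[OF A] N by simp
  also have "\<dots> = (\<Sum>i<N. (if i = 0 then d 1 * cofactor A i 0 else 0)
      + (if i = N - 1 then cofactor A i 0 else 0))"
    using N by (intro sum.cong) (auto simp: entry algebra_simps)
  also have "\<dots> = d 1 * cofactor A 0 0 + cofactor A (N - 1) 0"
    using N by (simp add: sum.distrib)
  also have "\<dots> = d 1 * (\<Prod>l = 2..N. d l) + (-1) ^ (N - 1)"
    unfolding cofactor_def upper lower by simp
  also have "d 1 * (\<Prod>l = 2..N. d l) = (\<Prod>l = 1..N. d l)"
    using N by (simp add: prod.atLeast_Suc_atMost numeral_2_eq_2)
  finally have "det A = (-1) ^ (N - 1) * (1 - beta d 1 N)"
    using N by (cases N) (auto simp: beta_def algebra_simps simp flip: power_mult_distrib)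
  then show ?thesis
    by (simp add: c_zero_def A_def norm_mult norm_power)
qed

lemma recurrence_solution:
  assumes rec: "\<And>m. 1 \<le> m \<Longrightarrow> m \<le> n \<Longrightarrow> z (Suc m) = y m - d m * z m"
  shows "z (Suc n) = beta d 1 n * z 1 + (\<Sum>k = 1..n. beta d (k + 1) n * y k)"
  using rec
proof (induction n)
  case 0
  then show ?case by simp
next
  case (Suc n)
  have "z (Suc (Suc n)) = y (Suc n) - d (Suc n) * z (Suc n)"
    using Suc.prems by simp
  also have "z (Suc n) = beta d 1 n * z 1 + (\<Sum>k = 1..n. beta d (k + 1) n * y k)"
    using Suc by simp
  finally have "z (Suc (Suc n)) = - d (Suc n) * beta d 1 n * z 1
      + (\<Sum>k = 1..n. - d (Suc n) * beta d (k + 1) n * y k) + y (Suc n)"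
    by (simp add: algebra_simps sum_distrib_left sum_negf)
  also have "- d (Suc n) * beta d 1 n = beta d 1 (Suc n)"
    by (simp add: beta_Suc)
  also have "(\<Sum>k = 1..n. - d (Suc n) * beta d (k + 1) n * y k) = (\<Sum>k = 1..n. beta d (k + 1) (Suc n) * y k)"
    by (intro sum.cong) (auto simp: beta_Suc)
  finally show ?case by simp
qed

text \<open>The outer index runs up to \<open>N + 1\<close>; the last inner sum holds the coefficients of the equation that
  closes the cycle.\<close>

lemma rho2_eq_double_sum:
  "(\<Sum>m = 1..Suc N. \<Sum>k = 1..m - 1. (cmod (beta d (k + 1) (m - 1)))\<^sup>2) = rho2 N d"
proof -
  have "rho2 N d = (\<Sum>(m, k) \<in> (SIGMA m:{1..Suc N}. {1..m - 1}). (cmod (beta d (k + 1) (m - 1)))\<^sup>2)"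
    unfolding rho2_def
    by (rule sum.reindex_bij_witness[of _ "\<lambda>(m, k). (k, m)" "\<lambda>(k, m). (m, k)"]) auto
  then show ?thesis
    by (subst sum.Sigma) auto
qed

text \<open>The pair \<open>(k, m) = (1, 2)\<close> contributes \<open>\<bar>\<beta>\<^sub>2\<^sub>,\<^sub>1\<bar>\<^sup>2 = 1\<close> to \<open>\<rho>\<^sub>N\<^sup>(\<^sup>2\<^sup>)\<close>. Positivity is what allows
  \<open>\<bar>x\<bar>\<^sup>2 \<le> \<rho>\<^sub>N \<bar>y\<bar>\<^sup>2\<close> to be turned into \<open>\<bar>x\<bar>\<^sup>2 / \<rho>\<^sub>N \<le> \<bar>y\<bar>\<^sup>2\<close>.\<close>

lemma rho_N_pos:
  assumes "1 \<le> N"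
  shows "0 < rho_N N d"
proof -
  have "0 \<le> rho1 N d"
    by (simp add: rho1_def c_zero_def sum_nonneg)
  moreover have "1 \<le> rho2 N d"
  proof -
    have "(1::real) = (\<Sum>k = 1..2 - 1. (cmod (beta d (k + 1) (2 - 1)))\<^sup>2)"
      by (simp add: beta_def)
    also have "\<dots> \<le> (\<Sum>m = 1..Suc N. \<Sum>k = 1..m - 1. (cmod (beta d (k + 1) (m - 1)))\<^sup>2)"
      using assms by (intro member_le_sum[of 2] sum_nonneg) auto
    finally show ?thesis by (simp only: rho2_eq_double_sum)
  qed
  ultimately show ?thesis
    by (simp add: rho_N_def)
qed

text \<open>The closing equation \<open>(1 - \<beta>\<^sub>1\<^sub>,\<^sub>N) x\<^sub>1 = \<Sum>\<^sub>k \<beta>\<^sub>k\<^sub>+\<^sub>1\<^sub>,\<^sub>N y\<^sub>k\<close> bounds \<open>\<bar>x\<^sub>1\<bar>\<^sup>2\<close> by \<open>\<bar>y\<bar>\<^sup>2\<close>. Inserted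
  into the unrolled recurrence, this part of \<open>x\<^sub>m\<close> produces \<open>\<rho>\<^sub>N\<^sup>(\<^sup>1\<^sup>)\<close>, and the remaining part produces
  \<open>\<rho>\<^sub>N\<^sup>(\<^sup>2\<^sup>)\<close>.\<close>

lemma cycle_sum_squares_le_rho:
  assumes N: "1 \<le> N" and c: "0 < c_zero N d"
  shows "(\<Sum>m = 1..N. (cmod (x m))\<^sup>2)
    \<le> rho_N N d * (\<Sum>k = 1..N. (cmod (d k * x k + x (cyc_next N k)))\<^sup>2)"
proof -
  define y where "y k = d k * x k + x (cyc_next N k)" for k
  \<comment> \<open>Index \<open>N + 1\<close> is a second copy of index 1, so that the recurrence
      holds without reduction modulo \<open>N\<close> and its last instance is the closing equation.\<close>
  define z where "z m = (if m = Suc N then x 1 else x m)" for m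
  define Y where "Y = (\<Sum>k = 1..N. (cmod (y k))\<^sup>2)"
  define S where "S m = (\<Sum>k = 1..m - 1. beta d (k + 1) (m - 1) * y k)" for m
  define R where "R m = (\<Sum>k = 1..m - 1. (cmod (beta d (k + 1) (m - 1)))\<^sup>2)" for m
  have rho1: "rho1 N d = (\<Sum>m = 1..N. (cmod (beta d 1 (m - 1)))\<^sup>2) * R (Suc N) / c_zero N d"
    by (simp add: rho1_def R_def)
  have Y: "0 \<le> Y"
    by (simp add: Y_def sum_nonneg)
  have sol: "z m = beta d 1 (m - 1) * x 1 + S m" if "1 \<le> m" "m \<le> Suc N" for m
  proof -
    have "z (Suc (m - 1)) = beta d 1 (m - 1) * z 1 + (\<Sum>k = 1..m - 1. beta d (k + 1) (m - 1) * y k)"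
      using that by (intro recurrence_solution) (auto simp: z_def y_def cyc_next_def)
    then show ?thesis
      using that N by (simp add: S_def z_def)
  qed
  have S_le: "(cmod (S m))\<^sup>2 \<le> R m * Y" if "m \<le> Suc N" for m
  proof -
    have "(cmod (S m))\<^sup>2 \<le> R m * (\<Sum>k = 1..m - 1. (cmod (y k))\<^sup>2)"
      unfolding S_def R_def by (rule norm_sum_mult_square_le)
    also have "\<dots> \<le> R m * Y"
      unfolding Y_def R_def using that by (intro mult_left_mono sum_mono2 sum_nonneg) auto
    finally show ?thesis .
  qed
  have "(1 - beta d 1 N) * x 1 = S (Suc N)"
    using sol[of "Suc N"] by (simp add: z_def algebra_simps)
  then have "c_zero N d * (cmod (x 1))\<^sup>2 = (cmod (S (Suc N)))\<^sup>2"
    by (metis c_zero_eq_beta[OF N] norm_mult power_mult_distrib)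
  then have x1: "(cmod (x 1))\<^sup>2 \<le> R (Suc N) * Y / c_zero N d"
    using S_le[of "Suc N"] c by (simp add: pos_le_divide_eq mult_ac)
  have "(cmod (x m))\<^sup>2 \<le> 2 * ((cmod (beta d 1 (m - 1)))\<^sup>2 * (R (Suc N) * Y / c_zero N d)) + 2 * (R m * Y)"
    if m: "m \<in> {1..N}" for m
  proof -
    have "(cmod (x m))\<^sup>2 \<le> (cmod (beta d 1 (m - 1) * x 1) + cmod (S m))\<^sup>2"
      using sol[of m] m by (simp add: z_def norm_triangle_ineq power_mono)
    also have "\<dots> \<le> 2 * (cmod (beta d 1 (m - 1) * x 1))\<^sup>2 + 2 * (cmod (S m))\<^sup>2"
      using sum_squares_bound[of "cmod (beta d 1 (m - 1) * x 1)" "cmod (S m)"]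
      by (simp add: power2_sum)
    also have "\<dots> \<le> 2 * ((cmod (beta d 1 (m - 1)))\<^sup>2 * (R (Suc N) * Y / c_zero N d)) + 2 * (R m * Y)"
      unfolding norm_mult power_mult_distrib
      using x1 S_le[of m] m by (intro add_mono mult_left_mono) auto
    finally show ?thesis .
  qed
  then have "(\<Sum>m = 1..N. (cmod (x m))\<^sup>2)
      \<le> (\<Sum>m = 1..N. 2 * ((cmod (beta d 1 (m - 1)))\<^sup>2 * (R (Suc N) * Y / c_zero N d)) + 2 * (R m * Y))"
    by (rule sum_mono)
  also have "\<dots> = 2 * (rho1 N d + (\<Sum>m = 1..N. R m)) * Y"
    unfolding sum.distrib sum_distrib_left[symmetric] sum_distrib_right[symmetric] rho1
    by (simp add: algebra_simps)
  also have "\<dots> \<le> rho_N N d * Y"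
  proof -
    have "(\<Sum>m = 1..N. R m) \<le> rho2 N d"
      unfolding rho2_eq_double_sum[symmetric] R_def by (intro sum_mono2) (auto intro: sum_nonneg)
    then show ?thesis
      using Y by (auto simp: rho_N_def intro!: mult_right_mono)
  qed
  finally show ?thesis
    by (simp add: Y_def y_def)
qed

text \<open>If \<open>D + U\<^sub>N\<close> is invertible, this is \<open>c\<^sub>0\<close> times the squared norm of a column of the inverse, or of
  a part of that column. The columns are numbered cyclically: \<open>k\<close> stands for column \<open>k - 1\<close>, and 1 for
  column \<open>N\<close>.\<close>

definition col_sum :: "nat \<Rightarrow> (nat \<Rightarrow> complex) \<Rightarrow> nat \<Rightarrow> real" where
  "col_sum N d k = (if k = 1 then \<Sum>m = 1..N. (cmod (beta d 1 (m - 1)))\<^sup>2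
                    else \<Sum>m = 1..N. (cmod (beta d k m))\<^sup>2)"

text \<open>Both sides are \<open>\<plusminus>\<Prod>\<^sub>l\<^sub>\<le>\<^sub>m d\<^sub>l \<cdot> \<Prod>\<^sub>k\<^sub>\<le>\<^sub>l\<^sub>\<le>\<^sub>N d\<^sub>l\<close>, because \<open>\<beta>\<^sub>j\<^sub>,\<^sub>N\<close> is \<open>\<beta>\<^sub>j\<^sub>,\<^sub>m\<close> times a factor that does not
  depend on \<open>j\<close>.\<close>

lemma beta_mult_exchange:
  assumes "k \<le> Suc m" "m \<le> N" "1 \<le> k"
  shows "beta d 1 m * beta d k N = beta d 1 N * beta d k m"
proof -
  have "beta d j N = beta d j m * ((-1) ^ (N - m) * (\<Prod>l = Suc m..N. d l))" if "j \<le> Suc m" "1 \<le> j" for j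
  proof -
    have "(\<Prod>l = j..N. d l) = (\<Prod>l = j..m. d l) * (\<Prod>l = Suc m..N. d l)"
      using that assms(2) prod.ub_add_nat[of j m d "N - m"] by simp
    moreover have "(-1 :: complex) ^ (Suc N - j) = (-1) ^ (Suc m - j) * (-1) ^ (N - m)"
      using that assms(2) by (simp flip: power_add)
    ultimately show ?thesis
      using that assms(2) by (simp add: beta_def)
  qed
  from this[of 1] this[of k] assms show ?thesis
    by simp
qed

text \<open>If \<open>D + U\<^sub>N\<close> is invertible, the sequence is \<open>1 - \<beta>\<^sub>1\<^sub>,\<^sub>N\<close> times column \<open>k - 1\<close> of the inverse, or
  column \<open>N\<close> for \<open>k = 1\<close>: the homogeneous recurrence holds at all indices except this one, where the defect is
  \<open>1 - \<beta>\<^sub>1\<^sub>,\<^sub>N\<close>. For \<open>k \<ge> 2\<close> it starts with the value 1 at index \<open>k\<close> and is continued around the cycle.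
  The formulas make sense for \<open>c\<^sub>0 = 0\<close> as well, and then give a kernel vector.\<close>

lemma cycle_test_sequence:
  assumes N: "1 \<le> N" and k: "k \<in> {1..N}"
  obtains x where "col_sum N d k \<le> (\<Sum>m = 1..N. (cmod (x m))\<^sup>2)"
    and "(\<Sum>j = 1..N. (cmod (d j * x j + x (cyc_next N j)))\<^sup>2) = c_zero N d"
proof (cases "k = 1")
  case True
  let ?x = "\<lambda>m. beta d 1 (m - 1)"
  have "d j * ?x j + ?x (cyc_next N j) = (if j = N then 1 - beta d 1 N else 0)" if "j \<in> {1..N}" for j
    using that beta_Suc[of 1 "j - 1" d] by (auto simp: cyc_next_def)
  then have "(\<Sum>j = 1..N. (cmod (d j * ?x j + ?x (cyc_next N j)))\<^sup>2)
      = (\<Sum>j = 1..N. if j = N then (cmod (1 - beta d 1 N))\<^sup>2 else 0)"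
    by (intro sum.cong) auto
  also have "\<dots> = c_zero N d"
    using N by (simp add: c_zero_eq_beta)
  finally show ?thesis
    using that[of ?x] True by (simp add: col_sum_def)
next
  case False
  with k have k: "2 \<le> k" "k \<le> N" by auto
  let ?x = "\<lambda>m. if k \<le> m then beta d k (m - 1) else beta d 1 (m - 1) * beta d k N"
  have jN: "d j * ?x j + ?x (cyc_next N j) = (if j = k - 1 then 1 - beta d 1 N else 0)"
    if j: "j \<in> {1..N}" for j
  proof -
    consider "j = N" | "j < N" "k \<le> j" | "j < N" "j = k - 1" | "j < N" "j < k - 1"
    proof -
      have "j = N \<or> j < N \<and> k \<le> j \<or> j < N \<and> j = k - 1 \<or> j < N \<and> j < k - 1"
        using j by (simp, linarith)
      then show thesis
        using that by blast
    qed
    then show ?thesis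
    proof cases
      case 1
      then show ?thesis
        using k beta_Suc[of k "N - 1" d] by (auto simp: cyc_next_def)
    next
      case 2
      then show ?thesis
        using k j beta_Suc[of k "j - 1" d] by (auto simp: cyc_next_def)
    next
      case 3
      \<comment> \<open>This is the index that carries the defect: \<open>x\<^sub>k\<close> is 1, whereas the recurrence would continue
          \<open>x\<^sub>k\<^sub>-\<^sub>1\<close> by \<open>\<beta>\<^sub>1\<^sub>,\<^sub>N\<close>.\<close>
      define i where "i = k - 2"
      have i: "k = Suc (Suc i)"
        using k by (simp add: i_def)
      have "beta d 1 N = beta d 1 (Suc i) * beta d k N"
        using i k beta_mult_exchange[of k "Suc i" N d] by simp
      also have "\<dots> = - (d (Suc i) * (beta d 1 i * beta d k N))"
        by (simp add: beta_Suc)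
      finally show ?thesis
        using 3 i by (simp add: cyc_next_def)
    next
      case 4
      then show ?thesis
        using k j beta_Suc[of 1 "j - 1" d] by (auto simp: cyc_next_def)
    qed
  qed
  have "(\<Sum>j = 1..N. (cmod (d j * ?x j + ?x (cyc_next N j)))\<^sup>2)
      = (\<Sum>j = 1..N. if j = k - 1 then (cmod (1 - beta d 1 N))\<^sup>2 else 0)"
    using jN by (intro sum.cong) auto
  also have "\<dots> = c_zero N d"
  proof -
    have "k - 1 \<in> {1..N}"
      using k by (simp, linarith)
    then show ?thesis
      by (simp only: sum.delta finite_atLeastAtMost if_True c_zero_eq_beta[OF N])
  qed
  finally have 2: "(\<Sum>j = 1..N. (cmod (d j * ?x j + ?x (cyc_next N j)))\<^sup>2) = c_zero N d" .
  have "col_sum N d k = (\<Sum>m = 1..N. (cmod (beta d k m))\<^sup>2)"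
    using k by (simp add: col_sum_def)
  \<comment> \<open>The summand \<open>m\<close> is the entry at index \<open>m + 1\<close>, and the last one wraps around to index 1. The
      entries at indices between 1 and \<open>k\<close> are bounded below by 0.\<close>
  also have "\<dots> = (\<Sum>m = k - 1..N. (cmod (beta d k m))\<^sup>2)"
    using k by (intro sum.mono_neutral_right) (auto simp: beta_def)
  also have "\<dots> = (\<Sum>m = k - 1..N - 1. (cmod (beta d k m))\<^sup>2) + (cmod (beta d k N))\<^sup>2"
    using k sum.cl_ivl_Suc[of "\<lambda>m. (cmod (beta d k m))\<^sup>2" "k - 1" "N - 1"] by simp
  also have "(\<Sum>m = k - 1..N - 1. (cmod (beta d k m))\<^sup>2) = (\<Sum>m = k..N. (cmod (?x m))\<^sup>2)"
    by (rule sum.reindex_bij_witness[of _ "\<lambda>m. m - 1" Suc]) (use k in auto)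
  also have "(cmod (beta d k N))\<^sup>2 = (cmod (?x 1))\<^sup>2"
    using k by (simp add: beta_def)
  also have "(\<Sum>m = k..N. (cmod (?x m))\<^sup>2) + (cmod (?x 1))\<^sup>2 = (\<Sum>m\<in>insert 1 {k..N}. (cmod (?x m))\<^sup>2)"
    using k by (subst sum.insert) auto
  also have "\<dots> \<le> (\<Sum>m = 1..N. (cmod (?x m))\<^sup>2)"
    using k by (intro sum_mono2) auto
  finally have 1: "col_sum N d k \<le> (\<Sum>m = 1..N. (cmod (?x m))\<^sup>2)" .
  show ?thesis
    by (rule that[of ?x, OF 1 2])
qed

lemma gamma_N_eq_Max_col_sum: "gamma_N N d = (MAX k\<in>{1..N}. col_sum N d k)"
  by (simp add: gamma_N_def col_sum_def)

text \<open>Already the sum for \<open>k = 1\<close> contains \<open>\<bar>\<beta>\<^sub>1\<^sub>,\<^sub>0\<bar>\<^sup>2 = 1\<close>. Positivity of \<open>\<gamma>\<^sub>N\<close> makes the test sequence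
  nonzero.\<close>

lemma gamma_N_ge_1:
  assumes "1 \<le> N"
  shows "1 \<le> gamma_N N d"
proof -
  have "1 = (cmod (beta d 1 (1 - 1)))\<^sup>2"
    by (simp add: beta_def)
  also have "\<dots> \<le> col_sum N d 1"
    using assms member_le_sum[of 1 "{1..N}" "\<lambda>m. (cmod (beta d 1 (m - 1)))\<^sup>2"]
    by (simp add: col_sum_def)
  also have "\<dots> \<le> gamma_N N d"
    unfolding gamma_N_eq_Max_col_sum using assms by (intro Max_ge) auto
  finally show ?thesis .
qed

lemma cycle_test_sequence_gamma:
  assumes N: "1 \<le> N"
  obtains x where "gamma_N N d \<le> (\<Sum>m = 1..N. (cmod (x m))\<^sup>2)"
    and "(\<Sum>j = 1..N. (cmod (d j * x j + x (cyc_next N j)))\<^sup>2) = c_zero N d"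
proof -
  have "gamma_N N d \<in> (\<lambda>k. col_sum N d k) ` {1..N}"
    unfolding gamma_N_eq_Max_col_sum using N by (intro Max_in) auto
  then obtain k where "k \<in> {1..N}" "gamma_N N d = col_sum N d k"
    by auto
  then show ?thesis
    using cycle_test_sequence[OF N, of k d] that by metis
qed

section \<open>Decomposition into cycles\<close>

text \<open>There are \<open>K\<close> cycles of lengths \<open>L i\<close>, and \<open>e i l\<close> is the \<open>l\<close>-th point of the \<open>i\<close>-th cycle. Working with an
  enumeration instead of a permutation lets the full shift be the case \<open>K = 1\<close>, \<open>e i l = l\<close>, in which
  the diagonal entries along the cycle are literally those of \<open>d\<close>.\<close>

locale cycle_partition =
  fixes N K :: nat and L :: "nat \<Rightarrow> nat" and e :: "nat \<Rightarrow> nat \<Rightarrow> nat" and h :: "nat \<Rightarrow> nat"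
  assumes N_pos: "1 \<le> N"
    and L_pos: "\<And>i. i \<in> {1..K} \<Longrightarrow> 1 \<le> L i"
    and bij: "bij_betw (\<lambda>(i, l). e i l) (SIGMA i:{1..K}. {1..L i}) {1..N}"
    and step: "\<And>i l. i \<in> {1..K} \<Longrightarrow> l \<in> {1..L i} \<Longrightarrow> h (e i l) = e i (cyc_next (L i) l)"
begin

lemma sum_cycles:
  fixes g :: "nat \<Rightarrow> real"
  shows "(\<Sum>j = 1..N. g j) = (\<Sum>i = 1..K. \<Sum>l = 1..L i. g (e i l))"
proof -
  have "(\<Sum>j = 1..N. g j) = (\<Sum>p\<in>(SIGMA i:{1..K}. {1..L i}). g ((\<lambda>(i, l). e i l) p))"
    by (rule sum.reindex_bij_betw[OF bij, symmetric])
  also have "\<dots> = (\<Sum>i = 1..K. \<Sum>l = 1..L i. g (e i l))"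
    by (subst sum.Sigma) (auto intro!: sum.cong)
  finally show ?thesis .
qed

lemma e_mem: "i \<in> {1..K} \<Longrightarrow> l \<in> {1..L i} \<Longrightarrow> e i l \<in> {1..N}"
  using bij_betw_apply[OF bij, of "(i, l)"] by simp

lemma e_surj:
  assumes "j \<in> {1..N}"
  obtains i l where "i \<in> {1..K}" "l \<in> {1..L i}" "j = e i l"
proof -
  have "j \<in> (\<lambda>(i, l). e i l) ` (SIGMA i:{1..K}. {1..L i})"
    using bij assms by (simp add: bij_betw_def)
  then show ?thesis
    using that by (auto simp del: atLeastAtMost_iff)
qed

lemma K_nonempty: "{1..K} \<noteq> {}"
  using e_surj[of 1] N_pos by fastforce

lemma cyc_next_mem: "i \<in> {1..K} \<Longrightarrow> l \<in> {1..L i} \<Longrightarrow> cyc_next (L i) l \<in> {1..L i}"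
  by (auto simp: cyc_next_def)

definition shifted where "shifted d = diag_matrix N d + perm_matrix N h"

lemma shifted_carrier: "shifted d \<in> carrier_mat N N"
  by (simp add: shifted_def diag_matrix_def perm_matrix_def mat1_def)

lemma sqnorm_cycles:
  assumes v: "v \<in> carrier_vec N"
  shows "sqnorm v = (\<Sum>i = 1..K. \<Sum>l = 1..L i. (cmod (v $ (e i l - 1)))\<^sup>2)"
proof -
  have "sqnorm v = (\<Sum>j = 1..N. (cmod (v $ (j - 1)))\<^sup>2)"
    using v unfolding sqnorm_def
    by (intro sum.reindex_bij_witness[of _ "\<lambda>j. j - 1" Suc]) auto
  then show ?thesis
    by (simp only: sum_cycles)
qed

lemma shifted_mult_entry:
  assumes v: "v \<in> carrier_vec N" and i: "i \<in> {1..K}" and l: "l \<in> {1..L i}"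
  shows "(shifted d *\<^sub>v v) $ (e i l - 1)
    = d (e i l) * v $ (e i l - 1) + v $ (e i (cyc_next (L i) l) - 1)"
proof -
  obtain a where a: "a < N" "e i l = Suc a"
    using e_mem[OF i l] by (cases "e i l") auto
  obtain b where b: "b < N" "e i (cyc_next (L i) l) = Suc b"
    using e_mem[OF i cyc_next_mem[OF i l]] by (cases "e i (cyc_next (L i) l)") auto
  have h: "h (Suc a) = Suc b"
    using step[OF i l] a(2) b(2) by simp
  have entry: "shifted d $$ (a, k) = (if k = a then d (Suc a) else 0) + (if k = b then 1 else 0)"
    if "k < N" for k
    using that a(1) h by (auto simp: shifted_def diag_matrix_def perm_matrix_def mat1_def)
  have "(shifted d *\<^sub>v v) $ a = (\<Sum>k = 0..<N. shifted d $$ (a, k) * v $ k)"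
    using shifted_carrier[of d] v a by (simp add: scalar_prod_def)
  also have "\<dots> = (\<Sum>k = 0..<N. (if k = a then d (Suc a) * v $ a else 0) + (if k = b then v $ b else 0))"
    by (intro sum.cong) (auto simp: entry distrib_right)
  also have "\<dots> = d (Suc a) * v $ a + v $ b"
    using a(1) b(1) by (simp add: sum.distrib)
  finally show ?thesis
    by (simp add: a(2) b(2))
qed

lemma sqnorm_shifted_cycles:
  assumes v: "v \<in> carrier_vec N"
  shows "sqnorm (shifted d *\<^sub>v v) = (\<Sum>i = 1..K. \<Sum>l = 1..L i.
    (cmod (d (e i l) * v $ (e i l - 1) + v $ (e i (cyc_next (L i) l) - 1)))\<^sup>2)"
proof -
  have Av: "shifted d *\<^sub>v v \<in> carrier_vec N"
    using shifted_carrier[of d] v by simp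
  show ?thesis
    unfolding sqnorm_cycles[OF Av] by (intro sum.cong refl) (simp only: shifted_mult_entry[OF v])
qed

definition cycle_entries where "cycle_entries d i l = d (e i l)" for d :: "nat \<Rightarrow> complex"

lemma sqnorm_shifted_lower:
  assumes c: "\<And>i. i \<in> {1..K} \<Longrightarrow> 0 < c_zero (L i) (cycle_entries d i)"
    and r: "\<And>i. i \<in> {1..K} \<Longrightarrow> r \<le> 1 / rho_N (L i) (cycle_entries d i)"
    and v: "v \<in> carrier_vec N"
  shows "r * sqnorm v \<le> sqnorm (shifted d *\<^sub>v v)"
proof -
  have "r * (\<Sum>l = 1..L i. (cmod (v $ (e i l - 1)))\<^sup>2)
      \<le> (\<Sum>l = 1..L i. (cmod (d (e i l) * v $ (e i l - 1) + v $ (e i (cyc_next (L i) l) - 1)))\<^sup>2)"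
    (is "_ * ?X \<le> ?Y") if i: "i \<in> {1..K}" for i
  proof -
    have rho: "0 < rho_N (L i) (cycle_entries d i)"
      using rho_N_pos L_pos[OF i] by simp
    have "r * ?X \<le> 1 / rho_N (L i) (cycle_entries d i) * ?X"
      by (intro mult_right_mono r[OF i] sum_nonneg) auto
    also have "?X \<le> rho_N (L i) (cycle_entries d i) * ?Y"
      using cycle_sum_squares_le_rho[OF L_pos[OF i] c[OF i], of "\<lambda>l. v $ (e i l - 1)"] by (simp add: cycle_entries_def)
    then have "1 / rho_N (L i) (cycle_entries d i) * ?X \<le> ?Y"
      using rho by (simp add: pos_divide_le_eq mult_ac)
    finally show ?thesis .
  qed
  note cycle = this
  show ?thesis
    unfolding sqnorm_cycles[OF v] sqnorm_shifted_cycles[OF v]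
    by (subst sum_distrib_left) (rule sum_mono, rule cycle)
qed

text \<open>The test sequence of one cycle is extended by 0 to the other cycles. The inverse of the
  enumeration tells to which cycle, and to which position on it, an index belongs.\<close>

lemma sqnorm_shifted_test_vector:
  assumes i: "i \<in> {1..K}"
  obtains v where "v \<in> carrier_vec N" "gamma_N (L i) (cycle_entries d i) \<le> sqnorm v"
    "sqnorm (shifted d *\<^sub>v v) = c_zero (L i) (cycle_entries d i)"
proof -
  obtain x where x: "gamma_N (L i) (cycle_entries d i) \<le> (\<Sum>l = 1..L i. (cmod (x l))\<^sup>2)"
    "(\<Sum>l = 1..L i. (cmod (cycle_entries d i l * x l + x (cyc_next (L i) l)))\<^sup>2) = c_zero (L i) (cycle_entries d i)"
    using cycle_test_sequence_gamma[OF L_pos[OF i]] by blast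
  define w where "w j = (case inv_into (SIGMA i:{1..K}. {1..L i}) (\<lambda>(i, l). e i l) j of
      (i', l) \<Rightarrow> if i' = i then x l else 0)" for j
  define v where "v = vec N (\<lambda>k. w (Suc k))"
  have v: "v \<in> carrier_vec N"
    by (simp add: v_def)
  have ve: "v $ (e i' l - 1) = (if i' = i then x l else 0)" if "i' \<in> {1..K}" "l \<in> {1..L i'}" for i' l
  proof -
    have "inv_into (SIGMA i:{1..K}. {1..L i}) (\<lambda>(i, l). e i l) (e i' l) = (i', l)"
      using inv_into_f_f[OF bij_betw_imp_inj_on[OF bij], of "(i', l)"] that by simp
    then have "w (e i' l) = (if i' = i then x l else 0)"
      by (simp add: w_def)
    then show ?thesis
      using e_mem[OF that] by (cases "e i' l") (auto simp: v_def)
  qed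
  have "sqnorm v = (\<Sum>i' = 1..K. if i' = i then \<Sum>l = 1..L i. (cmod (x l))\<^sup>2 else 0)"
    unfolding sqnorm_cycles[OF v]
  proof (intro sum.cong refl)
    fix i' assume i': "i' \<in> {1..K}"
    have "(\<Sum>l = 1..L i'. (cmod (v $ (e i' l - 1)))\<^sup>2)
      = (\<Sum>l = 1..L i'. if i' = i then (cmod (x l))\<^sup>2 else 0)"
      by (intro sum.cong refl) (simp only: ve[OF i'], simp)
    then show "(\<Sum>l = 1..L i'. (cmod (v $ (e i' l - 1)))\<^sup>2)
      = (if i' = i then \<Sum>l = 1..L i. (cmod (x l))\<^sup>2 else 0)"
      by simp
  qed
  then have 1: "sqnorm v = (\<Sum>l = 1..L i. (cmod (x l))\<^sup>2)"
    using i by simp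
  have "sqnorm (shifted d *\<^sub>v v) = (\<Sum>i' = 1..K. if i' = i then c_zero (L i) (cycle_entries d i) else 0)"
    unfolding sqnorm_shifted_cycles[OF v]
  proof (intro sum.cong refl)
    fix i' assume i': "i' \<in> {1..K}"
    have "(\<Sum>l = 1..L i'. (cmod (d (e i' l) * v $ (e i' l - 1) + v $ (e i' (cyc_next (L i') l) - 1)))\<^sup>2)
      = (\<Sum>l = 1..L i'. if i' = i then (cmod (cycle_entries d i l * x l + x (cyc_next (L i) l)))\<^sup>2 else 0)"
      by (intro sum.cong refl) (simp only: ve[OF i'] cyc_next_mem[OF i'], simp add: cycle_entries_def)
    then show "(\<Sum>l = 1..L i'. (cmod (d (e i' l) * v $ (e i' l - 1) + v $ (e i' (cyc_next (L i') l) - 1)))\<^sup>2)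
      = (if i' = i then c_zero (L i) (cycle_entries d i) else 0)"
      using x(2) by simp
  qed
  then have "sqnorm (shifted d *\<^sub>v v) = c_zero (L i) (cycle_entries d i)"
    using i by simp
  then show ?thesis
    using that[OF v] x(1) 1 by simp
qed

text \<open>If \<open>c\<^sub>0\<close> vanishes on some cycle, then the test vector of this cycle is a nonzero kernel vector.
  Otherwise the lower bound for the quotient excludes kernel vectors.\<close>

theorem invertible_iff: "invertible_mat (shifted d) \<longleftrightarrow> (\<forall>i\<in>{1..K}. 0 < c_zero (L i) (cycle_entries d i))"
proof
  assume inv: "invertible_mat (shifted d)"
  show "\<forall>i\<in>{1..K}. 0 < c_zero (L i) (cycle_entries d i)"
  proof
    fix i assume i: "i \<in> {1..K}"
    obtain v where v: "v \<in> carrier_vec N" "gamma_N (L i) (cycle_entries d i) \<le> sqnorm v"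
      "sqnorm (shifted d *\<^sub>v v) = c_zero (L i) (cycle_entries d i)"
      using sqnorm_shifted_test_vector[OF i] .
    have "sqnorm v \<noteq> 0"
      using v(2) gamma_N_ge_1[OF L_pos[OF i], of "cycle_entries d i"] by linarith
    then have "shifted d *\<^sub>v v \<noteq> 0\<^sub>v N"
      using inv v(1) invertible_mat_iff_kernel[OF shifted_carrier] sqnorm_eq_0_iff by blast
    moreover have "shifted d *\<^sub>v v \<in> carrier_vec N"
      using shifted_carrier[of d] v(1) by simp
    ultimately show "0 < c_zero (L i) (cycle_entries d i)"
      using sqnorm_pos v(3) by metis
  qed
next
  assume c: "\<forall>i\<in>{1..K}. 0 < c_zero (L i) (cycle_entries d i)"
  define r where "r = (MIN i\<in>{1..K}. 1 / rho_N (L i) (cycle_entries d i))"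
  have "0 < r"
    unfolding r_def using K_nonempty L_pos by (subst Min_gr_iff) (auto intro: rho_N_pos)
  show "invertible_mat (shifted d)"
    unfolding invertible_mat_iff_kernel[OF shifted_carrier]
  proof (intro ballI impI)
    fix v assume v: "v \<in> carrier_vec N" and 0: "shifted d *\<^sub>v v = 0\<^sub>v N"
    have "r * sqnorm v \<le> sqnorm (shifted d *\<^sub>v v)"
      using c v by (intro sqnorm_shifted_lower) (auto simp: r_def)
    also have "\<dots> = 0"
      by (simp add: 0 sqnorm_def)
    finally have "sqnorm v \<le> 0"
      using \<open>0 < r\<close> by (simp add: mult_le_0_iff)
    then show "v = 0\<^sub>v N"
      using sqnorm_eq_0_iff[OF v] sqnorm_nonneg[of v] by simp
  qed
qed

theorem s_min_bounds:
  assumes inv: "invertible_mat (shifted d)"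
  shows "(MIN i\<in>{1..K}. 1 / rho_N (L i) (cycle_entries d i)) \<le> (s_min (shifted d))\<^sup>2"
    and "(s_min (shifted d))\<^sup>2 \<le> (MIN i\<in>{1..K}. c_zero (L i) (cycle_entries d i) / gamma_N (L i) (cycle_entries d i))"
proof -
  show "(MIN i\<in>{1..K}. 1 / rho_N (L i) (cycle_entries d i)) \<le> (s_min (shifted d))\<^sup>2"
    using inv N_pos unfolding invertible_iff
    by (intro le_s_min_square[OF shifted_carrier] sqnorm_shifted_lower) auto
  have "(s_min (shifted d))\<^sup>2 \<le> c_zero (L i) (cycle_entries d i) / gamma_N (L i) (cycle_entries d i)" if i: "i \<in> {1..K}" for i
  proof -
    obtain v where v: "v \<in> carrier_vec N" "gamma_N (L i) (cycle_entries d i) \<le> sqnorm v"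
      "sqnorm (shifted d *\<^sub>v v) = c_zero (L i) (cycle_entries d i)"
      using sqnorm_shifted_test_vector[OF i] .
    have "(s_min (shifted d))\<^sup>2 * gamma_N (L i) (cycle_entries d i) \<le> (s_min (shifted d))\<^sup>2 * sqnorm v"
      using v(2) by (intro mult_left_mono) auto
    also have "\<dots> \<le> c_zero (L i) (cycle_entries d i)"
      using s_min_square_le[OF shifted_carrier v(1)] v(3) by metis
    finally show ?thesis
      using gamma_N_ge_1[OF L_pos[OF i], of "cycle_entries d i"] by (simp add: pos_le_divide_eq)
  qed
  then show "(s_min (shifted d))\<^sup>2 \<le> (MIN i\<in>{1..K}. c_zero (L i) (cycle_entries d i) / gamma_N (L i) (cycle_entries d i))"
    using K_nonempty by (intro Min.boundedI) auto
qed

end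

section \<open>The full shift and general permutations\<close>

lemma cyclic_shift_eq_perm_matrix: "cyclic_shift N = perm_matrix N (cyc_next N)"
  by (auto simp: cyclic_shift_def perm_matrix_def mat1_def cyc_next_def intro!: eq_matI)

lemma cycle_partition_single:
  assumes "1 \<le> N"
  shows "cycle_partition N 1 (\<lambda>_. N) (\<lambda>_ l. l) (cyc_next N)"
proof
  show "bij_betw (\<lambda>(i :: nat, l). l) (SIGMA i:{1..1}. {1..N}) {1..N}"
    by (rule bij_betw_byWitness[of _ "\<lambda>l. (1, l)"]) auto
qed (use assms in auto)

text \<open>Each point lies on exactly one of the listed cycles, which makes the enumeration surjective and
  separates the cycles; within one cycle the points are distinct. The exponent is \<open>l - 1\<close> because
  positions on a cycle are counted from 1.\<close>

lemma cycle_partition_perm: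
  assumes N: "1 \<le> N" and \<sigma>: "\<sigma> permutes {1..N}" and cyc: "cycles_of N \<sigma> K n"
  shows "cycle_partition N K (\<lambda>i. cycle_length \<sigma> (n i)) (\<lambda>i l. (\<sigma> ^^ (l - 1)) (n i)) \<sigma>"
proof
  have perm: "permutation \<sigma>"
    using \<sigma> permutation_permutes by blast
  have len: "cycle_length \<sigma> x = least_power \<sigma> x" for x
    by (simp add: cycle_length_def)
  show pos: "1 \<le> cycle_length \<sigma> (n i)" if "i \<in> {1..K}" for i
    using least_power_of_permutation(2)[OF perm, of "n i"] by (simp add: len)
  have n: "n i \<in> {1..N}" if "i \<in> {1..K}" for i
    using cyc that by (simp add: cycles_of_def)
  have supp: "(\<sigma> ^^ (l - 1)) (n i) \<in> set (support \<sigma> (n i))" if "l \<in> {1..cycle_length \<sigma> (n i)}" for i l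
    using that by (auto simp: len)
  show "bij_betw (\<lambda>(i, l). (\<sigma> ^^ (l - 1)) (n i)) (SIGMA i:{1..K}. {1..cycle_length \<sigma> (n i)}) {1..N}"
    unfolding bij_betw_def
  proof
    show "inj_on (\<lambda>(i, l). (\<sigma> ^^ (l - 1)) (n i)) (SIGMA i:{1..K}. {1..cycle_length \<sigma> (n i)})"
    proof (rule inj_onI, clarify)
      fix i l j m
      assume i: "i \<in> {1..K}" and l: "l \<in> {1..cycle_length \<sigma> (n i)}"
        and j: "j \<in> {1..K}" and m: "m \<in> {1..cycle_length \<sigma> (n j)}"
        and eq: "(\<sigma> ^^ (l - 1)) (n i) = (\<sigma> ^^ (m - 1)) (n j)"
      have "(\<sigma> ^^ (l - 1)) (n i) \<in> {1..N}"
        using permutes_in_image[OF permutes_funpow[OF \<sigma>]] n[OF i] by blast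
      then have "i = j"
        using cyc supp[OF l] supp[OF m] i j unfolding eq cycles_of_def by blast
      moreover have "l - 1 = m - 1"
      proof -
        have "distinct (support \<sigma> (n i))"
          using cycle_of_permutation[OF perm] .
        moreover have "l - 1 < least_power \<sigma> (n i)" "m - 1 < least_power \<sigma> (n i)"
          using l m \<open>i = j\<close> by (auto simp: len)
        ultimately show ?thesis
          using eq \<open>i = j\<close> by (auto simp: distinct_map inj_on_def)
      qed
      ultimately show "i = j \<and> l = m"
        using l m by auto
    qed
    show "(\<lambda>(i, l). (\<sigma> ^^ (l - 1)) (n i)) ` (SIGMA i:{1..K}. {1..cycle_length \<sigma> (n i)}) = {1..N}"
    proof (intro equalityI subsetI)
      fix x assume "x \<in> {1..N}"
      then obtain i where i: "i \<in> {1..K}" "x \<in> set (support \<sigma> (n i))"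
        using cyc unfolding cycles_of_def by blast
      then obtain l where "l < least_power \<sigma> (n i)" "x = (\<sigma> ^^ l) (n i)"
        by auto
      then show "x \<in> (\<lambda>(i, l). (\<sigma> ^^ (l - 1)) (n i)) ` (SIGMA i:{1..K}. {1..cycle_length \<sigma> (n i)})"
        using i(1) by (intro image_eqI[of _ _ "(i, Suc l)"]) (auto simp: len)
    next
      fix x assume "x \<in> (\<lambda>(i, l). (\<sigma> ^^ (l - 1)) (n i)) ` (SIGMA i:{1..K}. {1..cycle_length \<sigma> (n i)})"
      then obtain i l where i: "i \<in> {1..K}" and x: "x = (\<sigma> ^^ (l - 1)) (n i)"
        by (elim imageE SigmaE) (simp only: prod.case)
      show "x \<in> {1..N}"
        using permutes_in_image[OF permutes_funpow[OF \<sigma>], of "l - 1" "n i"] n[OF i] x by simp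
    qed
  qed
  show "\<sigma> ((\<sigma> ^^ (l - 1)) (n i)) = (\<sigma> ^^ (cyc_next (cycle_length \<sigma> (n i)) l - 1)) (n i)"
    if "i \<in> {1..K}" and l: "l \<in> {1..cycle_length \<sigma> (n i)}" for i l
  proof -
    have "\<sigma> ((\<sigma> ^^ (l - 1)) (n i)) = (\<sigma> ^^ l) (n i)"
      using l by (cases l) auto
    also have "\<dots> = (\<sigma> ^^ (cyc_next (cycle_length \<sigma> (n i)) l - 1)) (n i)"
      using least_power_of_permutation(1)[OF perm, of "n i"] by (simp add: cyc_next_def len)
    finally show ?thesis .
  qed
qed (fact N)

theorem theorem1p5:
  fixes N :: nat and d :: "nat \<Rightarrow> complex"
  assumes "N \<ge> 1"
  shows "((invertible_mat (diag_matrix N d + cyclic_shift N) \<longleftrightarrow> c_zero N d > 0) \<and>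
          (invertible_mat (diag_matrix N d + cyclic_shift N) \<longrightarrow>
             1 / rho_N N d \<le> (s_min (diag_matrix N d + cyclic_shift N))\<^sup>2 \<and>
             (s_min (diag_matrix N d + cyclic_shift N))\<^sup>2 \<le> c_zero N d / gamma_N N d))
       \<and> (\<forall>(\<sigma> :: nat \<Rightarrow> nat) (K :: nat) (n :: nat \<Rightarrow> nat).
            \<sigma> permutes {1..N} \<longrightarrow> cycles_of N \<sigma> K n \<longrightarrow>
            (let A = diag_matrix N d + perm_matrix N \<sigma>;
                 L = (\<lambda>i. cycle_length \<sigma> (n i));
                 D = (\<lambda>i. cycle_diag d \<sigma> (n i))
             in (invertible_mat A \<longleftrightarrow> (\<forall>i\<in>{1..K}. c_zero (L i) (D i) > 0)) \<and>
                (invertible_mat A \<longrightarrow>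
                   (MIN i\<in>{1..K}. 1 / rho_N (L i) (D i)) \<le> (s_min A)\<^sup>2 \<and>
                   (s_min A)\<^sup>2 \<le> (MIN i\<in>{1..K}. c_zero (L i) (D i) / gamma_N (L i) (D i)))))"
proof -
  interpret one: cycle_partition N 1 "\<lambda>_. N" "\<lambda>_ l. l" "cyc_next N"
    using assms by (rule cycle_partition_single)
  have A: "one.shifted d = diag_matrix N d + cyclic_shift N"
    by (simp add: one.shifted_def cyclic_shift_eq_perm_matrix)
  have D: "one.cycle_entries d i = d" for i
    by (simp add: one.cycle_entries_def fun_eq_iff)
  show ?thesis
  proof (rule conjI, goal_cases)
    case 1
    show ?case
      using one.invertible_iff[of d] one.s_min_bounds[of d] by (simp add: A D)
  next
    case 2
    show ?case
      unfolding Let_def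
    proof (intro allI impI, goal_cases)
      case (1 \<sigma> K n)
      then interpret part: cycle_partition N K "\<lambda>i. cycle_length \<sigma> (n i)" "\<lambda>i l. (\<sigma> ^^ (l - 1)) (n i)" \<sigma>
        using cycle_partition_perm assms by simp
      have D: "part.cycle_entries d = (\<lambda>i. cycle_diag d \<sigma> (n i))"
        by (intro ext) (simp only: part.cycle_entries_def cycle_diag_def)
      show ?case
        using part.invertible_iff[of d] part.s_min_bounds[of d] unfolding D part.shifted_def by blast
    qed
  qed
qed

end
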